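(* Let $m\geq 3$ be a fixed integer, and let $\theta(n)=\theta_{\mathsf{H}_m}(n)$ be the section growth function of the Hanoi automaton $\mathsf{H}_m$. Then $\theta(n)=\exp(O(\log^{m-2} n))$ as $n\to\infty$.
   Context: Automata. An automaton $\mathsf{A}$ over a finite alphabet $X$ is a finite directed labeled graph whose vertices are called states, such that for each state $s$ and each letter $x\in X$ there is a unique outgoing arrow at $s$ labeled $x|y$ for some $y\in X$. Let $X^{*}$ be the set of finite words over $X$ (including the empty word). For a state $s$ and a word $v=x_1x_2\ldots x_k\in X^{*}$ there is a unique directed path starting at $s$ labeled $x_1|y_1,\ldots,x_k|y_k$; the word $s(v):=y_1\ldots y_k$ is the image of $v$ under $s$, and the end vertex $s|_v$ of this path is the section of $s$ at $v$. Words over states. A word $s_1s_2\ldots s_n$ over the states acts on $X^{*}$ by composition, as a left action: $(s_1s_2\ldots s_n)(v)=(s_1\ldots s_{n-1})(s_n(v))$. The section of the word $s_1s_2\ldots s_n$ at $v\in X^{*}$ is the word over states $$(s_1s_2\ldots s_n)|_v=s_1's_2'\ldots s_n',\qquad s_i'=s_i|_{(s_{i+1}\ldots s_n)(v)}.$$ Sections are treated as words over states; two sections are equal if and only if they are equal as words of states. Section growth function. Let $\#Sections(s_1s_2\ldots s_k)$ be the number of distinct sections $(s_1s_2\ldots s_k)|_v$, $v\in X^{*}$. The section growth function of $\mathsf{A}$ is $$\theta_{\mathsf{A}}(n)=\max\{\#Sections(s_1s_2\ldots s_k) : s_i\in\mathsf{A},\ k\leq n\},\quad n=1,2,\ldots.$$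 Hanoi automaton. $\mathsf{H}_m$ is the automaton over the alphabet $X_m=\{1,2,\ldots,m\}$ whose states are a trivial state $e$ and one state $a_{(ij)}$ for every transposition $(i,j)$ on $X_m$. All arrows outgoing from $e$ end in $e$ and are labeled $x|x$, $x\in X_m$. Each state $a_{(ij)}$ has two arrows to $e$, labeled $i|j$ and $j|i$, and its other outgoing arrows are loops at $a_{(ij)}$ labeled $x|x$ for every $x\in X_m\setminus\{i,j\}$. Here $\log^{m-2} n$ means $(\log n)^{m-2}$, the constant implied by $O(\cdot)$ may depend on $m$, and the statement is an upper bound: $\theta(n)\leq\exp(f(n))$ for some function $f$ with $f(n)=O(\log^{m-2} n)$. *)

theory Defs
  imports Complex_Main "HOL-Library.Landau_Symbols" "HOL-Combinatorics.Transposition"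
begin

text \<open>
  An arrow from \<open>s\<close> to \<open>step A s x\<close> labeled \<open>x|out A s x\<close> leaves every state \<open>s\<close> for every
  letter \<open>x\<close>. The values of \<open>step\<close> and \<open>out\<close> outside \<open>states A\<close> and \<open>alphabet A\<close> are irrelevant.
\<close>

record ('s, 'x) automaton =
  states :: "'s set"
  alphabet :: "'x set"
  step :: "'s \<Rightarrow> 'x \<Rightarrow> 's"
  out :: "'s \<Rightarrow> 'x \<Rightarrow> 'x"

definition is_automaton :: "('s, 'x) automaton \<Rightarrow> bool" where
  "is_automaton A \<longleftrightarrow> finite (states A) \<and> finite (alphabet A) \<and>
     (\<forall>s\<in>states A. \<forall>x\<in>alphabet A. step A s x \<in> states A \<and> out A s x \<in> alphabet A)"

fun image :: "('s, 'x) automaton \<Rightarrow> 's \<Rightarrow> 'x list \<Rightarrow> 'x list" where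
  "image A s [] = []"
| "image A s (x # v) = out A s x # image A (step A s x) v"

fun section_of :: "('s, 'x) automaton \<Rightarrow> 's \<Rightarrow> 'x list \<Rightarrow> 's" where
  "section_of A s [] = s"
| "section_of A s (x # v) = section_of A (step A s x) v"

text \<open>Words over states act from the left: the last state of the list acts first.\<close>

fun word_image :: "('s, 'x) automaton \<Rightarrow> 's list \<Rightarrow> 'x list \<Rightarrow> 'x list" where
  "word_image A [] v = v"
| "word_image A (s # w) v = image A s (word_image A w v)"

fun word_section :: "('s, 'x) automaton \<Rightarrow> 's list \<Rightarrow> 'x list \<Rightarrow> 's list" where
  "word_section A [] v = []"
| "word_section A (s # w) v = section_of A s (word_image A w v) # word_section A w v"

definition sections :: "('s, 'x) automaton \<Rightarrow> 's list \<Rightarrow> 's list set" where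
  "sections A w = word_section A w ` lists (alphabet A)"

text \<open>
  The empty word is admitted; having a single section, it does not affect the maximum for
  \<open>n \<ge> 1\<close> when there is at least one state.
\<close>

definition section_growth :: "('s, 'x) automaton \<Rightarrow> nat \<Rightarrow> nat" where
  "section_growth A n = Max {card (sections A w) |w. w \<in> lists (states A) \<and> length w \<le> n}"

text \<open>
  \<open>Swap i j\<close> with \<open>i < j\<close> stands for the state of the transposition \<open>(i,j) = (j,i)\<close>; the
  ordering makes this one state per transposition.
\<close>

datatype hanoi_state = Triv | Swap nat nat

fun hanoi_step :: "hanoi_state \<Rightarrow> nat \<Rightarrow> hanoi_state" where
  "hanoi_step Triv x = Triv"
| "hanoi_step (Swap i j) x = (if x = i \<or> x = j then Triv else Swap i j)"

fun hanoi_out :: "hanoi_state \<Rightarrow> nat \<Rightarrow> nat" where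
  "hanoi_out Triv x = x"
| "hanoi_out (Swap i j) x = transpose i j x"

definition hanoi :: "nat \<Rightarrow> (hanoi_state, nat) automaton" where
  "hanoi m = \<lparr>states = insert Triv {Swap i j |i j. 1 \<le> i \<and> i < j \<and> j \<le> m},
              alphabet = {1..m}, step = hanoi_step, out = hanoi_out\<rparr>"

lemma is_automaton_hanoi: "is_automaton (hanoi m)"
proof -
  have "{Swap i j |i j. 1 \<le> i \<and> i < j \<and> j \<le> m} \<subseteq> case_prod Swap ` ({1..m} \<times> {1..m})"
    by auto
  then have "finite {Swap i j |i j. 1 \<le> i \<and> i < j \<and> j \<le> m}"
    by (rule finite_subset) simp
  moreover have "hanoi_step s x \<in> states (hanoi m) \<and> hanoi_out s x \<in> alphabet (hanoi m)"
    if "s \<in> states (hanoi m)" "x \<in> alphabet (hanoi m)" for s x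
    using that by (cases s) (simp_all add: hanoi_def transpose_def)
  ultimately show ?thesis
    by (simp add: is_automaton_def hanoi_def)
qed

text \<open>The cardinalities and the maximum above are taken over finite sets.\<close>

lemma length_image [simp]: "length (image A s v) = length v"
  by (induction v arbitrary: s) auto

lemma image_in_lists:
  assumes "is_automaton A" "s \<in> states A" "v \<in> lists (alphabet A)"
  shows "image A s v \<in> lists (alphabet A)"
  using assms(3,2) by (induction v arbitrary: s) (use assms(1) in \<open>auto simp: is_automaton_def\<close>)

lemma section_of_in_states:
  assumes "is_automaton A" "s \<in> states A" "v \<in> lists (alphabet A)"
  shows "section_of A s v \<in> states A"
  using assms(3,2) by (induction v arbitrary: s) (use assms(1) in \<open>auto simp: is_automaton_def\<close>)

lemma word_image_in_lists:
  assumes "is_automaton A" "w \<in> lists (states A)" "v \<in> lists (alphabet A)"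
  shows "word_image A w v \<in> lists (alphabet A)"
  using assms(2) by (induction w) (use assms in \<open>simp_all add: image_in_lists del: in_lists_conv_set\<close>)

lemma length_word_section [simp]: "length (word_section A w v) = length w"
  by (induction w) auto

lemma word_section_in_lists:
  assumes "is_automaton A" "w \<in> lists (states A)" "v \<in> lists (alphabet A)"
  shows "word_section A w v \<in> lists (states A)"
  using assms(2)
  by (induction w)
    (use assms in \<open>simp_all add: section_of_in_states word_image_in_lists del: in_lists_conv_set\<close>)

lemma finite_sections:
  assumes "is_automaton A" "w \<in> lists (states A)"
  shows "finite (sections A w)"
proof (rule finite_subset)
  show "sections A w \<subseteq> {u. set u \<subseteq> states A \<and> length u = length w}"
    using word_section_in_lists[OF assms] by (fastforce simp: sections_def)
  show "finite {u. set u \<subseteq> states A \<and> length u = length w}"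
    using assms(1) by (intro finite_lists_length_eq) (simp add: is_automaton_def)
qed

lemma finite_section_counts:
  assumes "is_automaton A"
  shows "finite {card (sections A w) |w. w \<in> lists (states A) \<and> length w \<le> n}"
proof -
  have "finite {w. set w \<subseteq> states A \<and> length w \<le> n}"
    using assms by (intro finite_lists_length_le) (simp add: is_automaton_def)
  then have "finite {w. w \<in> lists (states A) \<and> length w \<le> n}"
    by (simp add: lists_eq_set)
  then show ?thesis
    by simp
qed

end

theory Submission
  imports Defs "HOL-Real_Asymp.Real_Asymp"
begin

text \<open>
  A state of a word is replaced by \<open>Triv\<close> exactly when it moves the letter that passes through it,
  so sections are obtained by erasing transpositions. Call the set of letters occurring in the
  transpositions of \<open>w\<close> its support. A letter outside the support passes through \<open>w\<close> without
  changing anything, whereas a letter of the support erases the first transposition of \<open>w\<close> that it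
  meets. Hence a word has few sections as soon as, along every input, only few letters hit the
  current support: if that number is at most \<open>d\<close>, the sections form a tree of depth \<open>d\<close> and
  branching at most \<open>m\<close> (\<open>card_sections_le\<close>).

  The depth is bounded by induction on the size of the support. A word whose support has two
  letters repeats one transposition, and a letter of the support erases all its copies at once
  (\<open>depth_support_le_two\<close>). For a support \<open>S\<close> with at least three letters, cut the word into
  blocks whose support is a proper subset of \<open>S\<close>;
  single transpositions will do. By induction every block has some small depth \<open>D\<close>. Depth is
  subadditive, so two adjacent blocks together have depth at most \<open>2 * D\<close>. The letters of \<open>S\<close> are
  permuted among themselves by the whole word; therefore each letter of \<open>S\<close> that is read reaches
  every pair as a letter of \<open>S\<close>, and it erases something in each pair whose support is all of \<open>S\<close>.
  After \<open>2 * D + 1\<close> such letters no pair has support \<open>S\<close> any more, and each pair has become a single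
  block (\<open>blocks_lose_support\<close>). The number of blocks is thus halved at a cost of order \<open>D\<close>, and
  a word of length \<open>n\<close> needs about \<open>log 2 n\<close> halvings before a single block remains
  (\<open>depth_of_blocks\<close>). Each of the \<open>m - 2\<close> enlargements of the support from two letters to \<open>m\<close>
  letters contributes one logarithmic factor (\<open>depth_le_log_power\<close>).
\<close>

section \<open>Sections as erasure of transpositions\<close>

fun state_supp :: "hanoi_state \<Rightarrow> nat set" where
  "state_supp Triv = {}"
| "state_supp (Swap i j) = {i, j}"

definition supp :: "hanoi_state list \<Rightarrow> nat set" where
  "supp w = (\<Union>s\<in>set w. state_supp s)"

lemma supp_simps [simp]:
  "supp [] = {}" "supp (s # w) = state_supp s \<union> supp w" "supp (u @ w) = supp u \<union> supp w"
  by (auto simp: supp_def)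

lemma supp_concat: "supp (concat us) = (\<Union>u\<in>set us. supp u)"
  by (auto simp: supp_def)

lemma finite_state_supp [simp]: "finite (state_supp s)"
  by (cases s) auto

lemma finite_supp [simp]: "finite (supp w)"
  by (simp add: supp_def)

lemma card_state_supp_le: "card (state_supp s) \<le> 2"
  by (cases s) (auto simp: card_insert_if)

lemma hanoi_step_eq: "hanoi_step s x = (if x \<in> state_supp s then Triv else s)"
  by (cases s) auto

lemma hanoi_out_fixed: "x \<notin> state_supp s \<Longrightarrow> hanoi_out s x = x"
  by (cases s) auto

lemma hanoi_out_in_iff: "state_supp s \<subseteq> S \<Longrightarrow> hanoi_out s x \<in> S \<longleftrightarrow> x \<in> S"
  by (cases s) (auto simp: transpose_def)

fun act :: "hanoi_state list \<Rightarrow> nat \<Rightarrow> nat" where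
  "act [] x = x"
| "act (s # w) x = hanoi_out s (act w x)"

fun sec :: "hanoi_state list \<Rightarrow> nat \<Rightarrow> hanoi_state list" where
  "sec [] x = []"
| "sec (s # w) x = hanoi_step s (act w x) # sec w x"

text \<open>
  Images and sections are computed letter by letter, which fits induction on the input. Letters
  range over all natural numbers; those outside the support of a word are fixed by it.
\<close>

fun word_act :: "hanoi_state list \<Rightarrow> nat list \<Rightarrow> nat list" where
  "word_act w [] = []"
| "word_act w (x # v) = act w x # word_act (sec w x) v"

abbreviation word_sec :: "hanoi_state list \<Rightarrow> nat list \<Rightarrow> hanoi_state list" where
  "word_sec \<equiv> foldl sec"

lemma word_image_Nil: "word_image A w [] = []"
  by (induction w) auto

lemma word_section_Nil: "word_section A w [] = w"
  by (induction w) (auto simp: word_image_Nil)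

lemma word_image_hanoi_Cons:
  "word_image (hanoi m) w (x # v) = act w x # word_image (hanoi m) (sec w x) v"
  by (induction w) (auto simp: hanoi_def)

lemma word_section_hanoi_Cons:
  "word_section (hanoi m) w (x # v) = word_section (hanoi m) (sec w x) v"
  by (induction w) (auto simp: word_image_hanoi_Cons, simp add: hanoi_def)

lemma word_section_hanoi: "word_section (hanoi m) w v = word_sec w v"
  by (induction v arbitrary: w) (auto simp: word_section_Nil word_section_hanoi_Cons)

lemma act_append: "act (u @ w) x = act u (act w x)"
  by (induction u) auto

lemma sec_append: "sec (u @ w) x = sec u (act w x) @ sec w x"
  by (induction u) (auto simp: act_append)

lemma word_sec_append: "word_sec (u @ w) v = word_sec u (word_act w v) @ word_sec w v"
  by (induction v arbitrary: u w) (auto simp: sec_append)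

lemma act_fixed: "x \<notin> supp w \<Longrightarrow> act w x = x"
  by (induction w) (auto simp: hanoi_out_fixed)

lemma sec_fixed: "x \<notin> supp w \<Longrightarrow> sec w x = w"
  by (induction w) (auto simp: act_fixed hanoi_step_eq)

lemma act_in_iff: "supp w \<subseteq> S \<Longrightarrow> act w x \<in> S \<longleftrightarrow> x \<in> S"
  by (induction w) (auto simp: hanoi_out_in_iff)

lemma set_sec: "set (sec w x) \<subseteq> insert Triv (set w)"
  by (induction w) (auto simp: hanoi_step_eq)

lemma length_sec [simp]: "length (sec w x) = length w"
  by (induction w) auto

lemma set_word_sec: "set (word_sec w v) \<subseteq> insert Triv (set w)"
proof (induction v arbitrary: w)
  case (Cons x v)
  then show ?case using set_sec[of w x] Cons[of "sec w x"] by auto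
qed auto

lemma length_word_sec [simp]: "length (word_sec w v) = length w"
  by (induction v arbitrary: w) auto

lemma supp_word_sec: "supp (word_sec w v) \<subseteq> supp w"
  using set_word_sec[of w v] by (force simp: supp_def)

lemma supp_sec: "supp (sec w x) \<subseteq> supp w"
  using supp_word_sec[of w "[x]"] by simp

section \<open>The number of letters that hit the support\<close>

text \<open>
  A letter changes the section reached so far if and only if it lies in the support of that section.
  Hence this counts the steps along \<open>v\<close> that lead to a new section.
\<close>

fun cost :: "hanoi_state list \<Rightarrow> nat list \<Rightarrow> nat" where
  "cost w [] = 0"
| "cost w (x # v) = (if x \<in> supp w then 1 else 0) + cost (sec w x) v"

definition depth_le :: "hanoi_state list \<Rightarrow> nat \<Rightarrow> bool" where
  "depth_le w d \<longleftrightarrow> (\<forall>v. cost w v \<le> d)"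

abbreviation hits :: "nat set \<Rightarrow> nat list \<Rightarrow> nat" where
  "hits S v \<equiv> length (filter (\<lambda>x. x \<in> S) v)"

lemma cost_append: "cost w (v @ v') = cost w v + cost (word_sec w v) v'"
  by (induction v arbitrary: w) auto

text \<open>
  A letter that changes \<open>u @ w\<close> changes \<open>w\<close>, or it passes through \<open>w\<close> unmoved and then changes \<open>u\<close>.
\<close>

lemma cost_subadditive: "cost (u @ w) v \<le> cost u (word_act w v) + cost w v"
proof (induction v arbitrary: u w)
  case (Cons x v)
  have "cost (sec (u @ w) x) v \<le>
      cost (sec u (act w x)) (word_act (sec w x) v) + cost (sec w x) v"
    unfolding sec_append by (rule Cons)
  then show ?case by (cases "x \<in> supp w") (simp_all add: act_fixed le_SucI)
qed auto

lemma depth_le_append: "depth_le u d \<Longrightarrow> depth_le w d' \<Longrightarrow> depth_le (u @ w) (d + d')"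
  unfolding depth_le_def by (meson add_mono cost_subadditive order_trans)

lemma cost_empty_support: "supp w = {} \<Longrightarrow> cost w v = 0"
  by (induction v arbitrary: w) (auto simp: sec_fixed)

lemma cost_le_hits: "supp w \<subseteq> S \<Longrightarrow> cost w v \<le> hits S v"
proof (induction v arbitrary: w)
  case (Cons x v)
  then show ?case using Cons.IH[of "sec w x"] supp_sec[of w x] by (auto intro: le_SucI)
qed auto

text \<open>If all of \<open>S\<close> survives in the support until the end, every letter of \<open>S\<close> is counted.\<close>

lemma hits_le_cost: "S \<subseteq> supp (word_sec w v) \<Longrightarrow> hits S v \<le> cost w v"
proof (induction v arbitrary: w)
  case (Cons x v)
  then show ?case using Cons.IH[of "sec w x"] supp_word_sec[of w "x # v"] by (auto intro: le_SucI)
qed auto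

lemma hits_word_act: "supp w \<subseteq> S \<Longrightarrow> hits S (word_act w v) = hits S v"
proof (induction v arbitrary: w)
  case (Cons x v)
  then show ?case
    using Cons.IH[of "sec w x"] supp_sec[of w x] act_in_iff[of w S x] by auto
qed auto

lemma split_at_hits: "t \<le> hits S v \<Longrightarrow> \<exists>v1 v2. v = v1 @ v2 \<and> hits S v1 = t"
proof (induction v arbitrary: t)
  case (Cons x v)
  show ?case
  proof (cases "t = 0")
    case True
    then have "x # v = [] @ (x # v) \<and> hits S [] = t" by simp
    then show ?thesis by blast
  next
    case False
    define t' where "t' = (if x \<in> S then t - 1 else t)"
    have "t' \<le> hits S v" using Cons.prems False by (auto simp: t'_def split: if_splits)
    then obtain v1 v2 where "v = v1 @ v2" "hits S v1 = t'" using Cons.IH by blast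
    then have "x # v = (x # v1) @ v2 \<and> hits S (x # v1) = t" using False by (auto simp: t'_def)
    then show ?thesis by blast
  qed
qed auto

section \<open>Halving the number of blocks\<close>

text \<open>
  This is the reason why blocks can be merged: the trajectory of a letter of \<open>S\<close> stays in \<open>S\<close>, so
  all blocks read the same number of letters of \<open>S\<close>. If that number exceeds the depth of a block,
  then the block cannot have kept all of \<open>S\<close> in its support.
\<close>

lemma blocks_lose_support:
  assumes "\<forall>u\<in>set us. supp u \<subseteq> S \<and> depth_le u t" "t < hits S v"
  shows "\<exists>us'. word_sec (concat us) v = concat us' \<and> length us' = length us \<and>
           (\<forall>u\<in>set us'. supp u \<subset> S)"
  using assms(1)
proof (induction us)
  case Nil
  have "word_sec [] v = []" by (induction v) auto
  then show ?case by (intro exI[of _ "[]"]) auto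
next
  case (Cons u us)
  then obtain us' where us': "word_sec (concat us) v = concat us'" "length us' = length us"
    "\<forall>u\<in>set us'. supp u \<subset> S"
    by auto
  define v' where "v' = word_act (concat us) v"
  have "supp (concat us) \<subseteq> S"
    using Cons.prems by (auto simp: supp_concat)
  then have "t < hits S v'"
    using assms(2) by (simp add: v'_def hits_word_act)
  moreover have "cost u v' \<le> t"
    using Cons.prems by (auto simp: depth_le_def)
  ultimately have "\<not> S \<subseteq> supp (word_sec u v')"
    using hits_le_cost[of S u v'] by linarith
  then have "supp (word_sec u v') \<subset> S"
    using supp_word_sec[of u v'] Cons.prems by auto
  then show ?case
    using us' by (intro exI[of _ "word_sec u v' # us'"]) (auto simp: word_sec_append v'_def)
qed

fun pair_up :: "'a list list \<Rightarrow> 'a list list" where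
  "pair_up (a # b # us) = (a @ b) # pair_up us"
| "pair_up us = us"

lemma concat_pair_up: "concat (pair_up us) = concat us"
  by (induction us rule: pair_up.induct) auto

lemma length_pair_up: "2 * length (pair_up us) \<le> length us + 1"
  by (induction us rule: pair_up.induct) auto

lemma depth_le_pair_up:
  "\<forall>u\<in>set us. depth_le u d \<Longrightarrow> \<forall>u\<in>set (pair_up us). depth_le u (2 * d)"
proof (induction us rule: pair_up.induct)
  case (1 a b us)
  then show ?case using depth_le_append[of a d b d] by (auto simp: mult_2)
qed (auto simp: depth_le_def intro: order_trans)

text \<open>
  Excludes \<open>Swap i i\<close>, which is not a state of the automaton: for proper words, states other than
  \<open>Triv\<close> inside a two-letter support all have the same support.
\<close>

definition proper :: "hanoi_state list \<Rightarrow> bool" where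
  "proper w \<longleftrightarrow> (\<forall>s\<in>set w. s = Triv \<or> card (state_supp s) = 2)"

lemma proper_word_sec: "proper w \<Longrightarrow> proper (word_sec w v)"
  using set_word_sec[of w v] by (auto simp: proper_def)

text \<open>
  The hypothesis on \<open>D\<close> is the bound for smaller supports. One halving uses up \<open>2 * D + 1\<close> letters
  of \<open>S\<close>, rounded up to \<open>3 * D\<close>; the last remaining block costs \<open>D\<close>.
\<close>

lemma depth_of_blocks:
  assumes small: "\<And>u. proper u \<Longrightarrow> length u \<le> N \<Longrightarrow> supp u \<subset> S \<Longrightarrow> depth_le u D"
    and "D \<ge> 1"
  assumes "proper (concat us)" "length (concat us) \<le> N" "\<forall>u\<in>set us. supp u \<subset> S"
    "length us \<le> 2 ^ j"
  shows "depth_le (concat us) (D * (3 * j + 1))"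
  using assms(3-)
proof (induction j arbitrary: us)
  case 0
  show ?case
  proof (cases us)
    case Nil
    then show ?thesis by (auto simp: depth_le_def cost_empty_support)
  next
    case (Cons u us')
    then show ?thesis using 0 small[of u] by auto
  qed
next
  case (Suc j)
  have "depth_le u D" if "u \<in> set us" for u
  proof (rule small)
    show "proper u" using Suc.prems(1) that by (auto simp: proper_def)
    have "length u \<le> length (concat us)"
      using that by (auto simp: length_concat intro: member_le_sum_list)
    then show "length u \<le> N" using Suc.prems(2) by linarith
  qed (use Suc.prems(3) that in auto)
  then have pairs_depth: "\<forall>p\<in>set (pair_up us). depth_le p (2 * D)"
    by (intro depth_le_pair_up) auto
  have supp_us: "supp (concat us) \<subseteq> S"
    using Suc.prems(3) by (auto simp: supp_concat)
  have pairs_supp: "supp p \<subseteq> S" if "p \<in> set (pair_up us)" for p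
    using supp_us that unfolding concat_pair_up[of us, symmetric] by (auto simp: supp_concat)
  have "cost (concat us) v \<le> D * (3 * Suc j + 1)" for v
  proof (cases "hits S v \<le> 2 * D")
    case True
    then have "cost (concat us) v \<le> 2 * D" using cost_le_hits[OF supp_us, of v] by linarith
    then show ?thesis by (simp add: algebra_simps)
  next
    case False
    then obtain v1 v2 where v: "v = v1 @ v2" "hits S v1 = 2 * D + 1"
      using split_at_hits[of "2 * D + 1" S v] by auto
    obtain us' where us': "word_sec (concat (pair_up us)) v1 = concat us'"
      "length us' = length (pair_up us)" "\<forall>u\<in>set us'. supp u \<subset> S"
      using blocks_lose_support[of "pair_up us" S "2 * D" v1] pairs_depth pairs_supp v(2) by auto
    have eq: "word_sec (concat us) v1 = concat us'"
      using us'(1) by (simp add: concat_pair_up)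
    have "depth_le (concat us') (D * (3 * j + 1))"
    proof (rule Suc.IH)
      show "proper (concat us')" unfolding eq[symmetric] using Suc.prems(1) by (rule proper_word_sec)
      show "length (concat us') \<le> N" unfolding eq[symmetric] using Suc.prems(2) by simp
      show "length us' \<le> 2 ^ j" using us'(2) length_pair_up[of us] Suc.prems(4) by simp
    qed (use us'(3) in auto)
    then have "cost (word_sec (concat us) v1) v2 \<le> D * (3 * j + 1)"
      by (simp add: eq depth_le_def)
    moreover have "cost (concat us) v1 \<le> 3 * D"
      using cost_le_hits[OF supp_us, of v1] v(2) \<open>D \<ge> 1\<close> by auto
    ultimately show ?thesis by (simp add: v(1) cost_append algebra_simps)
  qed
  then show ?case by (simp add: depth_le_def)
qed

section \<open>Depth of words of given length and support\<close>

text \<open>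
  A word with at most two letters in its support uses only one transposition. A letter that
  enters such a word from the support keeps moving inside it and erases everything.
\<close>

lemma depth_support_le_two:
  assumes "proper w" "card (supp w) \<le> 2"
  shows "depth_le w 1"
proof -
  have erased: "supp (sec w x) = {}" if "x \<in> supp w" for x
  proof -
    have same: "s = Triv \<or> state_supp s = supp w" if "s \<in> set w" for s
    proof -
      have "state_supp s \<subseteq> supp w" using that by (auto simp: supp_def)
      then show ?thesis
        using assms that card_seteq[of "supp w" "state_supp s"] by (auto simp: proper_def)
    qed
    have "supp (sec w' x) = {}" if "set w' \<subseteq> set w" for w'
      using that
    proof (induction w')
      case (Cons s w')
      have "supp w' \<subseteq> supp w" using Cons.prems by (auto simp: supp_def)
      then have "act w' x \<in> supp w" using \<open>x \<in> supp w\<close> by (simp add: act_in_iff)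
      moreover have "s = Triv \<or> state_supp s = supp w" using same Cons.prems by simp
      ultimately have "state_supp (hanoi_step s (act w' x)) = {}" by (auto simp: hanoi_step_eq)
      then show ?case using Cons by simp
    qed auto
    then show ?thesis by simp
  qed
  have "cost w v \<le> 1" for v
  proof (induction v)
    case (Cons x v)
    then show ?case by (cases "x \<in> supp w") (simp_all add: erased cost_empty_support sec_fixed)
  qed auto
  then show ?thesis by (simp add: depth_le_def)
qed

lemma depth_le_log_power:
  assumes "proper w" "length w \<le> 2 ^ L" "card (supp w) \<le> k + 2"
  shows "depth_le w ((3 * L + 1) ^ k)"
  using assms
proof (induction k arbitrary: w)
  case 0
  then show ?case using depth_support_le_two by simp
next
  case (Suc k)
  show ?case
  proof (cases "card (supp w) \<le> k + 2")
    case True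
    have "(3 * L + 1) ^ k \<le> (3 * L + 1) ^ Suc k" by simp
    then show ?thesis using Suc.IH[OF Suc.prems(1,2) True]
      unfolding depth_le_def by (meson order_trans)
  next
    case False
    have blocks: "concat (map (\<lambda>s. [s]) w) = w" by (induction w) auto
    have "depth_le (concat (map (\<lambda>s. [s]) w)) ((3 * L + 1) ^ k * (3 * L + 1))"
    proof (rule depth_of_blocks[where S = "supp w" and N = "2 ^ L"])
      fix u assume u: "proper u" "length u \<le> 2 ^ L" "supp u \<subset> supp w"
      have "card (supp u) < card (supp w)" using u(3) by (simp add: psubset_card_mono)
      then show "depth_le u ((3 * L + 1) ^ k)" using u Suc.prems(3) by (intro Suc.IH) auto
    next
      show "\<forall>u\<in>set (map (\<lambda>s. [s]) w). supp u \<subset> supp w"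
      proof
        fix u assume "u \<in> set (map (\<lambda>s. [s]) w)"
        then obtain s where s: "s \<in> set w" "u = [s]" by auto
        have "card (state_supp s) < card (supp w)"
          using card_state_supp_le[of s] False by linarith
        then have "state_supp s \<noteq> supp w" by auto
        then show "supp u \<subset> supp w" using s by (auto simp: supp_def)
      qed
    qed (use Suc.prems blocks in auto)
    then show ?thesis by (simp only: blocks power_Suc mult.commute)
  qed
qed

section \<open>Counting sections\<close>

text \<open>
  The first letter that changes \<open>w\<close> can be chosen in at most \<open>m\<close> ways, and it decreases the depth;
  the term for \<open>w\<close> itself makes the base \<open>m + 1\<close>.
\<close>

lemma card_sections_le:
  assumes "depth_le w d"
  shows "finite (word_sec w ` lists {1..m}) \<and> card (word_sec w ` lists {1..m}) \<le> (m + 1) ^ d"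
  using assms
proof (induction d arbitrary: w)
  case 0
  have "supp w = {}"
  proof (rule ccontr)
    assume "supp w \<noteq> {}"
    then obtain x where "x \<in> supp w" by auto
    then have "cost w [x] = 1" by simp
    then show False using 0 by (metis depth_le_def le_zero_eq zero_neq_one)
  qed
  then have "sec w x = w" for x by (simp add: sec_fixed)
  then have "word_sec w v = w" for v by (induction v) auto
  then have "word_sec w ` lists {1..m} \<subseteq> {w}" by auto
  then show ?case using card_mono[of "{w}"] finite_subset[of _ "{w}"] by simp
next
  case (Suc d)
  define X where "X = supp w \<inter> {1..m}"
  define T where "T x = word_sec (sec w x) ` lists {1..m}" for x
  have T: "finite (T x) \<and> card (T x) \<le> (m + 1) ^ d" if "x \<in> X" for x
    unfolding T_def
  proof (rule Suc.IH, unfold depth_le_def, rule allI)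
    fix v
    have "cost w (x # v) \<le> Suc d" using Suc.prems unfolding depth_le_def by blast
    then show "cost (sec w x) v \<le> d" using that by (simp add: X_def)
  qed
  have sub: "word_sec w ` lists {1..m} \<subseteq> insert w (\<Union>x\<in>X. T x)"
  proof
    fix u assume "u \<in> word_sec w ` lists {1..m}"
    then obtain v where v: "v \<in> lists {1..m}" "u = word_sec w v" by auto
    have "word_sec w v \<in> insert w (\<Union>x\<in>X. T x)"
      using v(1)
    proof (induction v)
      case (Cons x v)
      then show ?case by (cases "x \<in> supp w") (auto simp: sec_fixed X_def T_def)
    qed auto
    then show "u \<in> insert w (\<Union>x\<in>X. T x)" using v(2) by simp
  qed
  have fin: "finite (insert w (\<Union>x\<in>X. T x))" using T by (auto simp: X_def)
  have "card (\<Union>x\<in>X. T x) \<le> (\<Sum>x\<in>X. card (T x))" by (rule card_UN_le) (simp add: X_def)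
  also have "\<dots> \<le> card X * (m + 1) ^ d" using T sum_bounded_above[of X "\<lambda>x. card (T x)"] by simp
  also have "\<dots> \<le> m * (m + 1) ^ d"
    using card_mono[of "{1..m}" X] by (simp add: X_def)
  finally have "card (insert w (\<Union>x\<in>X. T x)) \<le> m * (m + 1) ^ d + 1"
    using fin by (simp add: card_insert_if)
  also have "\<dots> \<le> (m + 1) ^ Suc d" by simp
  finally show ?case
    using card_mono[OF fin sub] finite_subset[OF sub fin] by linarith
qed

lemma section_growth_hanoi_le:
  assumes "m \<ge> 2" "n \<le> 2 ^ L"
  shows "section_growth (hanoi m) n \<le> (m + 1) ^ ((3 * L + 1) ^ (m - 2))"
  unfolding section_growth_def
proof (rule Max.boundedI)
  show "finite {card (sections (hanoi m) w) |w. w \<in> lists (states (hanoi m)) \<and> length w \<le> n}"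
    by (rule finite_section_counts[OF is_automaton_hanoi])
  show "{card (sections (hanoi m) w) |w. w \<in> lists (states (hanoi m)) \<and> length w \<le> n} \<noteq> {}"
    by (auto intro!: exI[of _ "[]"])
  fix a assume "a \<in> {card (sections (hanoi m) w) |w. w \<in> lists (states (hanoi m)) \<and> length w \<le> n}"
  then obtain w where w: "a = card (sections (hanoi m) w)" "set w \<subseteq> states (hanoi m)" "length w \<le> n"
    by auto
  have "proper w" using w(2) by (fastforce simp: proper_def hanoi_def)
  moreover have "supp w \<subseteq> {1..m}" using w(2) by (fastforce simp: supp_def hanoi_def)
  then have "card (supp w) \<le> (m - 2) + 2" using card_mono[of "{1..m}" "supp w"] assms(1) by simp
  ultimately have "depth_le w ((3 * L + 1) ^ (m - 2))"
    using w(3) assms(2) by (intro depth_le_log_power) auto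
  then have "card (word_sec w ` lists {1..m}) \<le> (m + 1) ^ ((3 * L + 1) ^ (m - 2))"
    using card_sections_le by blast
  moreover have "sections (hanoi m) w = word_sec w ` lists {1..m}"
    unfolding sections_def word_section_hanoi by (simp add: hanoi_def)
  ultimately show "a \<le> (m + 1) ^ ((3 * L + 1) ^ (m - 2))" using w(1) by simp
qed

theorem corollary1p1:
  fixes m :: nat
  assumes "m \<ge> 3"
  shows "\<exists>f :: nat \<Rightarrow> real. f \<in> O(\<lambda>n. ln (real n) ^ (m - 2)) \<and>
           (\<forall>n\<ge>1. real (section_growth (hanoi m) n) \<le> exp (f n))"
proof -
  \<comment> \<open>For \<open>L = \<lceil>log 2 n\<rceil>\<close> the bound \<open>L \<le> log 2 n + 1\<close> holds, so \<open>3 * L + 1 \<le> 3 * log 2 n + 4\<close>.\<close>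
  define f where "f n = ln (real (m + 1)) * (3 * log 2 (real n) + 4) ^ (m - 2)" for n :: nat
  have "(\<lambda>n::nat. 3 * log 2 (real n) + 4) \<in> O(\<lambda>n. ln (real n))"
    by real_asymp
  then have "(\<lambda>n::nat. (3 * log 2 (real n) + 4) ^ (m - 2)) \<in> O(\<lambda>n. ln (real n) ^ (m - 2))"
    by (rule landau_o.big_power)
  then have "f \<in> O(\<lambda>n. ln (real n) ^ (m - 2))"
    unfolding f_def using assms by (intro landau_o.big.cmult_in_iff[THEN iffD2]) auto
  moreover have "real (section_growth (hanoi m) n) \<le> exp (f n)" if "n \<ge> 1" for n
  proof -
    define L where "L = nat \<lceil>log 2 (real n)\<rceil>"
    have "log 2 (real n) \<ge> 0" using that by simp
    then have L: "log 2 (real n) \<le> real L" "real L \<le> log 2 (real n) + 1"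
      by (auto simp: L_def)
    have "real n = 2 powr log 2 (real n)" using that by simp
    also have "\<dots> \<le> 2 powr real L" using L(1) by simp
    also have "\<dots> = real (2 ^ L)" by (simp add: powr_realpow)
    finally have "n \<le> 2 ^ L" by linarith
    then have "section_growth (hanoi m) n \<le> (m + 1) ^ ((3 * L + 1) ^ (m - 2))"
      using assms by (intro section_growth_hanoi_le) auto
    then have "real (section_growth (hanoi m) n) \<le> real (m + 1) ^ ((3 * L + 1) ^ (m - 2))"
      by (metis of_nat_le_iff of_nat_power)
    also have "\<dots> = exp (ln (real (m + 1)) * real ((3 * L + 1) ^ (m - 2)))"
      unfolding exp_of_nat2_mult by simp
    also have "\<dots> \<le> exp (f n)"
    proof -
      have "real ((3 * L + 1) ^ (m - 2)) \<le> (3 * log 2 (real n) + 4) ^ (m - 2)"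
        unfolding of_nat_power using L(2) by (intro power_mono) auto
      then show ?thesis by (simp add: f_def mult_left_mono)
    qed
    finally show ?thesis .
  qed
  ultimately show ?thesis by blast
qed

end
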